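(* Let $(U^n)_{n\in\mathbb N}\subset V_h$ solve the leapfrog scheme with $U^0=U^1=0$, and let $u_{h\tau}:=R(U)$, $w_{h\tau}:=L(U)$, $f_\tau:=R((f(t^n))_{n\in\mathbb N})$. Then $$(\ddot w_{h\tau}(t),v_h)_\Omega+(\nabla u_{h\tau}(t),\nabla v_h)_\Omega=(f_\tau(t),v_h)_\Omega\qquad\forall t\in J,\ \forall v_h\in V_h.$$
   Context: $\Omega\subset\mathbb R^d$, $d\ge1$, is an open bounded Lipschitz polyhedron, $J:=[0,+\infty)$, $V:=H^1_0(\Omega)$, $(\cdot,\cdot)_\Omega$ is the $L^2(\Omega)$ inner product (also for vector-valued functions). The source $f\in H^1(J;L^2(\Omega))\cap L^\infty(J;L^2(\Omega))$ is supported away from zero, i.e. it vanishes for $t$ in a neighborhood of $0$ in $J$. $\mathcal T_h$ is an affine simplicial mesh covering $\Omega$ exactly, and $V_h\subset V$ is the space of continuous, piecewise polynomial functions of degree at most $k\ge1$ on $\mathcal T_h$ vanishing on $\partial\Omega$. $\tau>0$ is a constant time step, $t^n:=n\tau$, $J_n:=[t^n,t^{n+1})$ for $n\in\mathbb N$ ($0\in\mathbb N$). The leapfrog scheme is: $\frac1{\tau^2}(U^{n+1}-2U^n+U^{n-1},v_h)_\Omega+(\nabla U^n,\nabla v_h)_\Omega=(f(t^n),v_h)_\Omega$ for all $n\ge1$, $v_h\in V_h$. Sequences are extended by zero to negative indices. For a sequence $W=(W^n)_{n\in\mathbb N}$ and $t\in J_n$, $$R(W)(t):=W^n+\frac{W^{n+1}-W^{n-1}}{2\tau}(t-t^n)+\frac{W^{n+1}-2W^n+W^{n-1}}{\tau^2}\frac12(t-t^n)^2,$$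 $$L(W)(t):=\alpha^n+\beta^n(t-t^n)+\gamma^n\tfrac12(t-t^n)^2+\vartheta^n\tfrac16(t-t^n)^3+\epsilon^n\tfrac1{24}(t-t^n)^4,$$ with $\alpha^n=\frac{3W^{n+1}+17W^n+5W^{n-1}-W^{n-2}}{24}$, $\beta^n=\frac{5W^{n+1}+3W^n-9W^{n-1}+W^{n-2}}{12\tau}$, $\gamma^n=\frac{W^{n+1}-2W^n+W^{n-1}}{\tau^2}$, $\vartheta^n=\frac{W^{n+2}-2W^{n+1}+2W^{n-1}-W^{n-2}}{2\tau^3}$, $\epsilon^n=\frac{W^{n+2}-4W^{n+1}+6W^n-4W^{n-1}+W^{n-2}}{\tau^4}$. The function $L(W)$ is of class $C^2$ in time, so $\ddot w_{h\tau}(t)$ is defined for all $t\in J$. *)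

theory Defs
  imports "HOL-Analysis.Analysis"
begin

text \<open>Elements of the Lebesgue and Sobolev spaces are represented by functions on the whole type, of which only the
  values almost everywhere on the set matter.\<close>

definition L2 :: "'a::euclidean_space set \<Rightarrow> ('a \<Rightarrow> 'b::euclidean_space) set" where
  "L2 S = {u. u \<in> borel_measurable (lebesgue_on S) \<and>
              integrable (lebesgue_on S) (\<lambda>x. (norm (u x))\<^sup>2)}"

definition L2_inner ::
  "'a::euclidean_space set \<Rightarrow> ('a \<Rightarrow> 'b::euclidean_space) \<Rightarrow> ('a \<Rightarrow> 'b) \<Rightarrow> real" where
  "L2_inner S u v = (\<integral>x. u x \<bullet> v x \<partial>lebesgue_on S)"

definition L2_norm :: "'a::euclidean_space set \<Rightarrow> ('a \<Rightarrow> 'b::euclidean_space) \<Rightarrow> real" where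
  "L2_norm S u = sqrt (L2_inner S u u)"

definition partial :: "'a::euclidean_space \<Rightarrow> ('a \<Rightarrow> real) \<Rightarrow> 'a \<Rightarrow> real" where
  "partial b \<phi> x = frechet_derivative \<phi> (at x) b"

primrec C_k :: "nat \<Rightarrow> ('a::euclidean_space \<Rightarrow> real) \<Rightarrow> bool" where
  "C_k 0 \<phi> \<longleftrightarrow> continuous_on UNIV \<phi>"
| "C_k (Suc m) \<phi> \<longleftrightarrow> \<phi> differentiable_on UNIV \<and> (\<forall>b\<in>Basis. C_k m (partial b \<phi>))"

definition test_functions :: "'a::euclidean_space set \<Rightarrow> ('a \<Rightarrow> real) set" where
  "test_functions S = {\<phi>. (\<forall>m. C_k m \<phi>) \<and> compact (closure {x. \<phi> x \<noteq> 0}) \<and>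
                          closure {x. \<phi> x \<noteq> 0} \<subseteq> S}"

definition weak_gradient ::
  "'a::euclidean_space set \<Rightarrow> ('a \<Rightarrow> real) \<Rightarrow> ('a \<Rightarrow> 'a) \<Rightarrow> bool" where
  "weak_gradient S u g \<longleftrightarrow>
     (\<forall>\<phi>\<in>test_functions S. \<forall>b\<in>Basis.
        L2_inner S u (partial b \<phi>) = - L2_inner S (\<lambda>x. g x \<bullet> b) \<phi>)"

definition H1 :: "'a::euclidean_space set \<Rightarrow> ('a \<Rightarrow> real) set" where
  "H1 S = {u \<in> L2 S. \<exists>g\<in>L2 S. weak_gradient S u g}"

text \<open>The weak gradient is unique up to null sets, so the choice below is immaterial.\<close>

definition grad :: "'a::euclidean_space set \<Rightarrow> ('a \<Rightarrow> real) \<Rightarrow> ('a \<Rightarrow> 'a)" where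
  "grad S u = (SOME g. g \<in> L2 S \<and> weak_gradient S u g)"

definition H1_norm :: "'a::euclidean_space set \<Rightarrow> ('a \<Rightarrow> real) \<Rightarrow> real" where
  "H1_norm S u = sqrt ((L2_norm S u)\<^sup>2 + (L2_norm S (grad S u))\<^sup>2)"

definition H1_0 :: "'a::euclidean_space set \<Rightarrow> ('a \<Rightarrow> real) set" where
  "H1_0 S = {u \<in> H1 S. \<exists>\<phi>. (\<forall>m. \<phi> m \<in> test_functions S) \<and>
                           (\<lambda>m. H1_norm S (\<lambda>x. u x - \<phi> m x)) \<longlonglongrightarrow> 0}"

abbreviation J :: "real set" where
  "J \<equiv> {0..}"

definition strongly_measurable ::
  "'a::euclidean_space set \<Rightarrow> (real \<Rightarrow> 'a \<Rightarrow> real) \<Rightarrow> bool" where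
  "strongly_measurable S f \<longleftrightarrow>
     (AE t in lebesgue_on J. f t \<in> L2 S) \<and>
     (\<exists>s. (\<forall>m. simple_function (lebesgue_on J) (s m) \<and> s m ` J \<subseteq> L2 S) \<and>
          (AE t in lebesgue_on J. (\<lambda>m. L2_norm S (\<lambda>x. s m t x - f t x)) \<longlonglongrightarrow> 0))"

definition L2_J_L2 :: "'a::euclidean_space set \<Rightarrow> (real \<Rightarrow> 'a \<Rightarrow> real) set" where
  "L2_J_L2 S = {f. strongly_measurable S f \<and>
                   integrable (lebesgue_on J) (\<lambda>t. (L2_norm S (f t))\<^sup>2)}"

definition Linf_J_L2 :: "'a::euclidean_space set \<Rightarrow> (real \<Rightarrow> 'a \<Rightarrow> real) set" where
  "Linf_J_L2 S = {f. strongly_measurable S f \<and>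
                     (\<exists>C. AE t in lebesgue_on J. L2_norm S (f t) \<le> C)}"

text \<open>The identity between the \<open>L2 S\<close>-valued Bochner integrals of \<open>\<lambda>t. deriv \<phi> t * f t\<close> and
  \<open>\<lambda>t. - \<phi> t * g t\<close> is expressed by pairing it with every element of the Hilbert space \<open>L2 S\<close>:
  Bochner integrals commute with continuous functionals.\<close>

definition weak_time_derivative ::
  "'a::euclidean_space set \<Rightarrow> (real \<Rightarrow> 'a \<Rightarrow> real) \<Rightarrow> (real \<Rightarrow> 'a \<Rightarrow> real) \<Rightarrow> bool" where
  "weak_time_derivative S f g \<longleftrightarrow>
     (\<forall>\<phi>\<in>test_functions {0<..}. \<forall>v\<in>L2 S.
        (\<integral>t. deriv \<phi> t * L2_inner S (f t) v \<partial>lebesgue_on J)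
          = - (\<integral>t. \<phi> t * L2_inner S (g t) v \<partial>lebesgue_on J))"

definition H1_J_L2 :: "'a::euclidean_space set \<Rightarrow> (real \<Rightarrow> 'a \<Rightarrow> real) set" where
  "H1_J_L2 S = {f \<in> L2_J_L2 S. \<exists>g\<in>L2_J_L2 S. weak_time_derivative S f g}"

text \<open>Every class in \<open>H1_J_L2 S\<close> has exactly one continuous representative; it is the one whose
  point values \<open>f t\<close> are meant when an \<open>H1\<close>-in-time function is evaluated at a given time.\<close>

definition continuous_J_L2 :: "'a::euclidean_space set \<Rightarrow> (real \<Rightarrow> 'a \<Rightarrow> real) \<Rightarrow> bool" where
  "continuous_J_L2 S f \<longleftrightarrow>
     (\<forall>t\<in>J. f t \<in> L2 S \<and> ((\<lambda>s. L2_norm S (\<lambda>x. f s x - f t x)) \<longlongrightarrow> 0) (at t within J))"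

definition vanishes_near_0 :: "'a::euclidean_space set \<Rightarrow> (real \<Rightarrow> 'a \<Rightarrow> real) \<Rightarrow> bool" where
  "vanishes_near_0 S f \<longleftrightarrow> (\<exists>\<delta>>0. \<forall>t\<in>{0..<\<delta>}. AE x in lebesgue_on S. f t x = 0)"

text \<open>Near each boundary point the set is, in suitable orthonormal coordinates, the strict
  epigraph of a Lipschitz function of the coordinates orthogonal to the unit vector \<open>e\<close>.\<close>

definition lipschitz_boundary :: "'a::euclidean_space set \<Rightarrow> bool" where
  "lipschitz_boundary S \<longleftrightarrow>
     (\<forall>x\<in>frontier S. \<exists>r>0. \<exists>e C. \<exists>\<psi>::'a \<Rightarrow> real.
        norm e = 1 \<and> C-lipschitz_on UNIV \<psi> \<and>
        S \<inter> ball x r = {y \<in> ball x r. \<psi> (y - (y \<bullet> e) *\<^sub>R e) < y \<bullet> e})"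

text \<open>Polyhedra in this sense need not be convex.\<close>

definition lipschitz_polyhedron :: "'a::euclidean_space set \<Rightarrow> bool" where
  "lipschitz_polyhedron S \<longleftrightarrow>
     open S \<and> bounded S \<and> lipschitz_boundary S \<and>
     (\<exists>P. finite P \<and> (\<forall>p\<in>P. polytope p) \<and> closure S = \<Union>P)"

text \<open>The cells are non-overlapping, but hanging nodes are not excluded.\<close>

definition simplicial_mesh :: "'a::euclidean_space set \<Rightarrow> 'a set set \<Rightarrow> bool" where
  "simplicial_mesh S \<T> \<longleftrightarrow>
     finite \<T> \<and> (\<forall>K\<in>\<T>. int DIM('a) simplex K) \<and>
     (\<forall>K\<in>\<T>. \<forall>K'\<in>\<T>. K \<noteq> K' \<longrightarrow> interior K \<inter> interior K' = {}) \<and>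
     \<Union>\<T> = closure S"

definition polys :: "nat \<Rightarrow> (real ^ 'd \<Rightarrow> real) set" where
  "polys k = {p. \<exists>c :: ('d \<Rightarrow> nat) \<Rightarrow> real.
     p = (\<lambda>x. \<Sum>\<alpha> | (\<Sum>i\<in>UNIV. \<alpha> i) \<le> k. c \<alpha> * (\<Prod>i\<in>UNIV. (x $ i) ^ \<alpha> i))}"

text \<open>On a mesh of a Lipschitz polyhedron the other conditions imply membership in \<open>H1_0 \<Omega>\<close>; it is included because the space is
  introduced as a subspace of \<open>H1_0 \<Omega>\<close>.\<close>

definition V_h :: "(real ^ 'd) set \<Rightarrow> (real ^ 'd) set set \<Rightarrow> nat \<Rightarrow> (real ^ 'd \<Rightarrow> real) set" where
  "V_h \<Omega> \<T> k = {v \<in> H1_0 \<Omega>. continuous_on (closure \<Omega>) v \<and>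
                  (\<forall>K\<in>\<T>. \<exists>p\<in>polys k. \<forall>x\<in>K. v x = p x) \<and>
                  (\<forall>x\<in>frontier \<Omega>. v x = 0)}"

definition leapfrog ::
  "(real ^ 'd) set \<Rightarrow> (real ^ 'd) set set \<Rightarrow> nat \<Rightarrow> real \<Rightarrow> (real \<Rightarrow> real ^ 'd \<Rightarrow> real) \<Rightarrow>
   (nat \<Rightarrow> real ^ 'd \<Rightarrow> real) \<Rightarrow> bool" where
  "leapfrog \<Omega> \<T> k \<tau> f U \<longleftrightarrow>
     (\<forall>n. U n \<in> V_h \<Omega> \<T> k) \<and>
     (\<forall>n\<ge>1. \<forall>v\<in>V_h \<Omega> \<T> k.
        1 / \<tau>\<^sup>2 * L2_inner \<Omega> (\<lambda>x. U (n + 1) x - 2 * U n x + U (n - 1) x) v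
          + L2_inner \<Omega> (grad \<Omega> (U n)) (grad \<Omega> v)
        = L2_inner \<Omega> (f (real n * \<tau>)) v)"

definition zero_ext :: "(nat \<Rightarrow> real) \<Rightarrow> int \<Rightarrow> real" where
  "zero_ext W n = (if n < 0 then 0 else W (nat n))"

text \<open>The index \<open>n\<close> with \<open>t \<in> J\<^sub>n\<close> is \<open>\<lfloor>t / \<tau>\<rfloor>\<close>.\<close>

definition R_scalar :: "real \<Rightarrow> (nat \<Rightarrow> real) \<Rightarrow> real \<Rightarrow> real" where
  "R_scalar \<tau> W0 t =
     (let n = \<lfloor>t / \<tau>\<rfloor>; s = t - of_int n * \<tau>; W = zero_ext W0 in
        W n + (W (n + 1) - W (n - 1)) / (2 * \<tau>) * s
            + (W (n + 1) - 2 * W n + W (n - 1)) / \<tau>\<^sup>2 * (1 / 2) * s\<^sup>2)"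

definition L_scalar :: "real \<Rightarrow> (nat \<Rightarrow> real) \<Rightarrow> real \<Rightarrow> real" where
  "L_scalar \<tau> W0 t =
     (let n = \<lfloor>t / \<tau>\<rfloor>; s = t - of_int n * \<tau>; W = zero_ext W0;
          \<alpha> = (3 * W (n + 1) + 17 * W n + 5 * W (n - 1) - W (n - 2)) / 24;
          \<beta> = (5 * W (n + 1) + 3 * W n - 9 * W (n - 1) + W (n - 2)) / (12 * \<tau>);
          \<gamma> = (W (n + 1) - 2 * W n + W (n - 1)) / \<tau>\<^sup>2;
          \<theta> = (W (n + 2) - 2 * W (n + 1) + 2 * W (n - 1) - W (n - 2)) / (2 * \<tau> ^ 3);
          \<epsilon> = (W (n + 2) - 4 * W (n + 1) + 6 * W n - 4 * W (n - 1) + W (n - 2)) / \<tau> ^ 4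
      in \<alpha> + \<beta> * s + \<gamma> * (1 / 2) * s\<^sup>2 + \<theta> * (1 / 6) * s ^ 3 + \<epsilon> * (1 / 24) * s ^ 4)"

definition R :: "real \<Rightarrow> (nat \<Rightarrow> 'a \<Rightarrow> real) \<Rightarrow> real \<Rightarrow> 'a \<Rightarrow> real" where
  "R \<tau> W t x = R_scalar \<tau> (\<lambda>n. W n x) t"

definition L :: "real \<Rightarrow> (nat \<Rightarrow> 'a \<Rightarrow> real) \<Rightarrow> real \<Rightarrow> 'a \<Rightarrow> real" where
  "L \<tau> W t x = L_scalar \<tau> (\<lambda>n. W n x) t"

text \<open>For functions of time with values in a finite-dimensional space of functions, such as
  \<open>V_h \<Omega> \<T> k\<close>, the derivative is the pointwise one. At \<open>t = 0\<close> it is one-sided.\<close>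

definition time_deriv :: "(real \<Rightarrow> 'a \<Rightarrow> real) \<Rightarrow> real \<Rightarrow> 'a \<Rightarrow> real" where
  "time_deriv w t x = vector_derivative (\<lambda>s. w s x) (at t within J)"

end

theory Submission
  imports Defs
begin

text \<open>On each time interval, \<open>R \<tau> W\<close> is the quadratic that interpolates the values of \<open>W\<close> at the three nodes
  around it in the centred-difference form; at an offset \<open>s\<close> from the node \<open>n\<close> it is a combination of
  \<open>W (n - 1)\<close>, \<open>W n\<close> and \<open>W (n + 1)\<close> with weights that depend on \<open>s\<close>
  and \<open>\<tau>\<close> only. The quartic \<open>L \<tau> W\<close> is designed such that its pieces fit together with two continuous derivatives and that its second derivative is the same
  quadratic reconstruction, applied to the second differences of \<open>W\<close> (lemma
  \<open>time_deriv_time_deriv_L\<close>). So the three terms of the claim at a time \<open>t\<close> are combinations,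
  with equal weights, of the three terms of the leapfrog scheme at the nodes \<open>n - 1\<close>, \<open>n\<close> and
  \<open>n + 1\<close>, and the claim follows by adding up the scheme. For \<open>n = 0\<close> and \<open>n = 1\<close> this involves the nodes
  \<open>-1\<close> and \<open>0\<close>, where the scheme holds for the sequences extended by zero because everything
  vanishes (lemma \<open>leapfrog_extended\<close>).

  Adding up uses that \<open>L2_inner S (grad S u) h\<close> is linear in \<open>u\<close>. As \<^const>\<open>grad\<close> selects some weak
  gradient, this rests on the uniqueness of weak gradients up to null sets, that is, on the
  fundamental lemma of the calculus of variations (\<open>ae_zero_if_orthogonal_test_functions\<close>): a function
  orthogonal to all test functions has vanishing integrals over boxes, because indicators of boxes
  are limits of products of smooth bumps, and then it vanishes at its Lebesgue points.\<close>

section \<open>The two reconstructions in time\<close>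

text \<open>The matching conditions make the piece on any interval agree with the function
  on the closed interval, right end point included. At a node the two one-sided derivatives can
  therefore be read off from the two adjacent pieces. The index runs over all integers, so that
  \<open>t = 0\<close> is a node like any other.\<close>
lemma floor_piecewise_has_derivative:
  fixes p p' :: "int \<Rightarrow> real \<Rightarrow> real" and \<tau> :: real
  assumes \<tau>: "\<tau> > 0"
    and deriv: "\<And>n s. (p n has_real_derivative p' n s) (at s)"
    and match: "\<And>n. p n \<tau> = p (n + 1) 0" "\<And>n. p' n \<tau> = p' (n + 1) 0"
  shows "((\<lambda>t. p \<lfloor>t / \<tau>\<rfloor> (t - of_int \<lfloor>t / \<tau>\<rfloor> * \<tau>)) has_real_derivative
           p' \<lfloor>t / \<tau>\<rfloor> (t - of_int \<lfloor>t / \<tau>\<rfloor> * \<tau>)) (at t)"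
proof -
  define F where "F t = p \<lfloor>t / \<tau>\<rfloor> (t - of_int \<lfloor>t / \<tau>\<rfloor> * \<tau>)" for t
  define n where "n = \<lfloor>t / \<tau>\<rfloor>"
  have F_eq: "F x = p m (x - of_int m * \<tau>)" if "of_int m * \<tau> \<le> x" "x \<le> of_int (m + 1) * \<tau>" for m x
  proof (cases "x = of_int (m + 1) * \<tau>")
    case True
    moreover have "x - of_int m * \<tau> = \<tau>"
      using True by (simp add: algebra_simps)
    ultimately show ?thesis
      using \<tau> match(1)[of m] by (simp add: F_def)
  next
    case False
    then have "\<lfloor>x / \<tau>\<rfloor> = m"
      using that \<tau> by (simp add: floor_eq_iff field_simps)
    then show ?thesis
      by (simp add: F_def)
  qed
  have piece: "((\<lambda>x. p m (x - of_int m * \<tau>)) has_real_derivative p' m (t - of_int m * \<tau>)) (at t within T)" for m and T :: "real set"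
  proof -
    have "((\<lambda>x. x - of_int m * \<tau>) has_real_derivative 1) (at t within T)"
      by (auto intro!: derivative_eq_intros)
    from DERIV_chain2[OF deriv this] show ?thesis
      by simp
  qed
  have n: "of_int n * \<tau> \<le> t" "t < of_int (n + 1) * \<tau>"
    using floor_correct[of "t / \<tau>"] unfolding n_def
    by (simp_all only: pos_le_divide_eq[OF \<tau>] pos_divide_less_eq[OF \<tau>])
  have right: "(F has_real_derivative p' n (t - of_int n * \<tau>)) (at t within {t..})"
    by (rule has_field_derivative_transform_within[OF piece[of n], where d = "of_int (n + 1) * \<tau> - t"])
       (use n in \<open>auto simp: dist_real_def intro!: F_eq[symmetric]\<close>)
  have left: "(F has_real_derivative p' n (t - of_int n * \<tau>)) (at t within {..t})"
  proof (cases "of_int n * \<tau> < t")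
    case True
    show ?thesis
      by (rule has_field_derivative_transform_within[OF piece[of n], where d = "t - of_int n * \<tau>"])
         (use n True in \<open>auto simp: dist_real_def intro!: F_eq[symmetric]\<close>)
  next
    case False
    then have t: "t = of_int n * \<tau>"
      using n by simp
    have "(F has_real_derivative p' (n - 1) (t - of_int (n - 1) * \<tau>)) (at t within {..t})"
    proof (rule has_field_derivative_transform_within[OF piece[of "n - 1"] \<tau>])
      fix x assume "x \<in> {..t}" "dist x t < \<tau>"
      then have "of_int (n - 1) * \<tau> \<le> x" "x \<le> of_int (n - 1 + 1) * \<tau>"
        by (auto simp: t dist_real_def algebra_simps)
      then show "p (n - 1) (x - of_int (n - 1) * \<tau>) = F x"
        by (rule F_eq[symmetric])
    qed simp
    moreover have "p' (n - 1) (t - of_int (n - 1) * \<tau>) = p' n (t - of_int n * \<tau>)"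
      using match(2)[of "n - 1"] by (simp add: t algebra_simps)
    ultimately show ?thesis
      by simp
  qed
  have "(F has_real_derivative p' n (t - of_int n * \<tau>)) (at t within {..t} \<union> {t..})"
    using left right unfolding has_field_derivative_iff by (rule Lim_Un)
  moreover have "{..t} \<union> {t..} = UNIV"
    by auto
  ultimately have "(F has_real_derivative p' n (t - of_int n * \<tau>)) (at t)"
    by simp
  then show ?thesis
    by (simp add: F_def[abs_def] n_def)
qed

lemma time_deriv_eqI:
  assumes "((\<lambda>s. w s x) has_real_derivative d) (at t within J)" "t \<in> J"
  shows "time_deriv w t x = d"
  unfolding time_deriv_def
proof (rule vector_derivative_within)
  have "at t within {t<..} \<le> at t within J"
    using assms by (intro at_le) auto
  then show "at t within J \<noteq> bot"
    using trivial_limit_at_right_real[of t] by (metis bot.extremum_uniqueI)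
qed (use assms in \<open>simp add: has_real_derivative_iff_has_vector_derivative\<close>)

definition second_diff :: "real \<Rightarrow> (int \<Rightarrow> real) \<Rightarrow> int \<Rightarrow> real" where
  "second_diff \<tau> W n = (W (n + 1) - 2 * W n + W (n - 1)) / \<tau>\<^sup>2"

text \<open>The local quadratic of \<^const>\<open>R_scalar\<close>, sorted by the values at the nodes \<open>n - 1\<close>, \<open>n\<close>, \<open>n + 1\<close>
  instead of by powers of \<open>s\<close>: the weight of the value at the node \<open>n + j\<close>, at the offset \<open>s\<close> from
  the node \<open>n\<close>. It is meant for \<open>j\<close> in \<open>{-1, 0, 1}\<close>.\<close>
definition node_weight :: "real \<Rightarrow> int \<Rightarrow> real \<Rightarrow> real" where
  "node_weight \<tau> j s =
     (if j = 0 then 1 - s\<^sup>2 / \<tau>\<^sup>2 else of_int j * s / (2 * \<tau>) + s\<^sup>2 / (2 * \<tau>\<^sup>2))"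

text \<open>Unlike \<^const>\<open>R_scalar\<close>, this takes a sequence indexed by all integers. The second differences of
  a sequence extended by zero need not vanish at the index \<open>-1\<close>, so they are not of the form
  \<open>zero_ext W\<close>.\<close>
definition quad_interp :: "real \<Rightarrow> (int \<Rightarrow> real) \<Rightarrow> real \<Rightarrow> real" where
  "quad_interp \<tau> W t =
     (\<Sum>j\<in>{-1, 0, 1}. node_weight \<tau> j (t - of_int \<lfloor>t / \<tau>\<rfloor> * \<tau>) * W (\<lfloor>t / \<tau>\<rfloor> + j))"

lemma R_scalar_eq_quad_interp:
  assumes "\<tau> > 0"
  shows "R_scalar \<tau> W t = quad_interp \<tau> (zero_ext W) t"
  unfolding R_scalar_def quad_interp_def node_weight_def Let_def
  using assms by (simp add: field_simps)

text \<open>The identity behind the choice of the coefficients of \<^const>\<open>L_scalar\<close>. The constant and linear ones make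
  the quartic pieces \<open>p n\<close> fit together with two continuous derivatives, and the others say that
  \<open>\<gamma> n\<close> is the second difference at \<open>n\<close>, while \<open>\<theta> n\<close> and \<open>\<epsilon> n\<close> are the centred first and second
  difference quotients of \<open>\<gamma>\<close>. Hence \<open>p'' n\<close> is the quadratic that interpolates the second
  differences.\<close>
lemma time_deriv_time_deriv_L:
  assumes \<tau>: "\<tau> > 0" and t: "t \<in> J"
  shows "time_deriv (time_deriv (L \<tau> U)) t x
           = quad_interp \<tau> (second_diff \<tau> (zero_ext (\<lambda>n. U n x))) t"
proof -
  define W where "W = zero_ext (\<lambda>n. U n x)"
  define \<alpha> where "\<alpha> n = (3 * W (n + 1) + 17 * W n + 5 * W (n - 1) - W (n - 2)) / 24" for n
  define \<beta> where "\<beta> n = (5 * W (n + 1) + 3 * W n - 9 * W (n - 1) + W (n - 2)) / (12 * \<tau>)" for n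
  define \<gamma> where "\<gamma> n = (W (n + 1) - 2 * W n + W (n - 1)) / \<tau>\<^sup>2" for n
  define \<theta> where "\<theta> n = (W (n + 2) - 2 * W (n + 1) + 2 * W (n - 1) - W (n - 2)) / (2 * \<tau> ^ 3)" for n
  define \<epsilon> where "\<epsilon> n = (W (n + 2) - 4 * W (n + 1) + 6 * W n - 4 * W (n - 1) + W (n - 2)) / \<tau> ^ 4" for n
  define p where "p n s = \<alpha> n + \<beta> n * s + \<gamma> n * (1 / 2) * s\<^sup>2 + \<theta> n * (1 / 6) * s ^ 3 + \<epsilon> n * (1 / 24) * s ^ 4" for n s
  define p' where "p' n s = \<beta> n + \<gamma> n * s + \<theta> n * (1 / 2) * s\<^sup>2 + \<epsilon> n * (1 / 6) * s ^ 3" for n s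
  define p'' where "p'' n s = \<gamma> n + \<theta> n * s + \<epsilon> n * (1 / 2) * s\<^sup>2" for n s
  have shift: "n + 1 + 1 = n + 2" "n + 1 - 1 = n" "n + 1 - 2 = n - 1" for n :: int
    by auto
  note coeffs = \<alpha>_def \<beta>_def \<gamma>_def \<theta>_def \<epsilon>_def shift
  have p: "(p n has_real_derivative p' n s) (at s)" for n s
    unfolding p_def p'_def by (auto intro!: derivative_eq_intros)
  have p': "(p' n has_real_derivative p'' n s) (at s)" for n s
    unfolding p'_def p''_def by (auto intro!: derivative_eq_intros)
  \<comment> \<open>The common knot values involve only \<open>W (n + 2)\<close>, \<open>W (n + 1)\<close>, \<open>W n\<close> and \<open>W (n - 1)\<close>:
    the contributions of \<open>W (n - 2)\<close> cancel.\<close>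
  have match: "p n \<tau> = p (n + 1) 0" "p' n \<tau> = p' (n + 1) 0" "p'' n \<tau> = p'' (n + 1) 0" for n
    unfolding p_def p'_def p''_def coeffs
    using \<tau> by (simp_all add: field_simps power2_eq_square power3_eq_cube power4_eq_xxxx)
  have L_eq: "L \<tau> U s x = p \<lfloor>s / \<tau>\<rfloor> (s - of_int \<lfloor>s / \<tau>\<rfloor> * \<tau>)" for s
    by (simp add: L_def L_scalar_def Let_def p_def \<alpha>_def \<beta>_def \<gamma>_def \<theta>_def \<epsilon>_def W_def)
  have first: "time_deriv (L \<tau> U) s x = p' \<lfloor>s / \<tau>\<rfloor> (s - of_int \<lfloor>s / \<tau>\<rfloor> * \<tau>)" if "s \<in> J" for s
    using floor_piecewise_has_derivative[of \<tau> p p', OF \<tau> p match(1,2)] that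
    by (intro time_deriv_eqI) (auto simp: L_eq intro: has_field_derivative_at_within)
  have "time_deriv (time_deriv (L \<tau> U)) t x = p'' \<lfloor>t / \<tau>\<rfloor> (t - of_int \<lfloor>t / \<tau>\<rfloor> * \<tau>)"
  proof (rule time_deriv_eqI[OF _ t])
    have "((\<lambda>s. p' \<lfloor>s / \<tau>\<rfloor> (s - of_int \<lfloor>s / \<tau>\<rfloor> * \<tau>)) has_real_derivative
        p'' \<lfloor>t / \<tau>\<rfloor> (t - of_int \<lfloor>t / \<tau>\<rfloor> * \<tau>)) (at t within J)"
      using floor_piecewise_has_derivative[of \<tau> p' p'', OF \<tau> p' match(2,3)]
      by (rule has_field_derivative_at_within)
    then show "((\<lambda>s. time_deriv (L \<tau> U) s x) has_real_derivative
        p'' \<lfloor>t / \<tau>\<rfloor> (t - of_int \<lfloor>t / \<tau>\<rfloor> * \<tau>)) (at t within J)"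
      by (rule has_field_derivative_transform_within[where d = 1]) (use t first in auto)
  qed
  also have "\<dots> = quad_interp \<tau> (second_diff \<tau> W) t"
    unfolding p''_def quad_interp_def second_diff_def node_weight_def \<gamma>_def \<theta>_def \<epsilon>_def
    using \<tau> by (simp add: field_simps power2_eq_square power3_eq_cube power4_eq_xxxx)
  finally show ?thesis
    by (simp add: W_def)
qed

section \<open>Smooth bumps supported in boxes\<close>

text \<open>The polynomial factor makes this family closed under differentiation, so that smoothness of
  \<open>exp_bump 1\<close> is a single induction.\<close>
definition exp_bump :: "real poly \<Rightarrow> real \<Rightarrow> real" where
  "exp_bump p x = (if x > 0 then poly p (1 / x) * exp (- 1 / x) else 0)"

lemma poly_div_exp_tendsto_0: "((\<lambda>z. poly q z / exp z) \<longlongrightarrow> (0::real)) at_top"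
proof -
  have "((\<lambda>z. \<Sum>i\<le>degree q. coeff q i * (z ^ i / exp z)) \<longlongrightarrow> (\<Sum>i\<le>degree q. coeff q i * 0)) at_top"
    by (intro tendsto_intros tendsto_power_div_exp_0)
  then show ?thesis
    by (simp add: poly_altdef sum_divide_distrib)
qed

lemma exp_bump_tendsto_0: "(exp_bump q \<longlongrightarrow> 0) (at_right 0)"
proof -
  have "((\<lambda>y. poly q (inverse y) / exp (inverse y)) \<longlongrightarrow> 0) (at_right 0)"
    by (rule filterlim_compose[OF poly_div_exp_tendsto_0 filterlim_inverse_at_top_right])
  then show ?thesis
    by (rule Lim_transform_eventually)
       (auto simp: eventually_at_filter exp_bump_def exp_minus field_simps)
qed

text \<open>For positive \<open>x\<close> the derivative of \<open>p (1 / x) exp (- 1 / x)\<close> is \<open>q (1 / x) exp (- 1 / x)\<close> with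
  \<open>q = X\<^sup>2 (p - p')\<close>. At \<open>0\<close> the difference quotient from the right is \<open>exp_bump (X p)\<close>, which tends to \<open>0\<close>
  because exponentials dominate polynomials.\<close>
lemma exp_bump_has_derivative:
  "(exp_bump p has_real_derivative exp_bump ([:0, 0, 1:] * (p - pderiv p)) x) (at x)"
proof (cases x "0 :: real" rule: linorder_cases)
  case less
  have "((\<lambda>x. 0) has_real_derivative 0) (at x)"
    by simp
  then have "(exp_bump p has_real_derivative 0) (at x)"
    by (rule has_field_derivative_transform_within_open[where S = "{..<0}"])
       (use less in \<open>auto simp: exp_bump_def\<close>)
  then show ?thesis
    using less by (simp add: exp_bump_def)
next
  case equal
  have left: "((\<lambda>y. exp_bump p y / y) \<longlongrightarrow> 0) (at_left 0)"
    by (rule Lim_transform_eventually[OF tendsto_const])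
       (auto simp: eventually_at_filter exp_bump_def)
  have right: "((\<lambda>y. exp_bump p y / y) \<longlongrightarrow> 0) (at_right 0)"
    by (rule Lim_transform_eventually[OF exp_bump_tendsto_0[of "pCons 0 p"]])
       (auto simp: eventually_at_filter exp_bump_def)
  have "((\<lambda>y. exp_bump p y / y) \<longlongrightarrow> 0) (at 0)"
    using filterlim_split_at[OF left right] .
  then show ?thesis
    using equal by (simp add: has_field_derivative_iff exp_bump_def)
next
  case greater
  have "((\<lambda>y. poly p (1 / y)) has_real_derivative poly (pderiv p) (1 / x) * (- 1 / x\<^sup>2)) (at x)"
    by (rule DERIV_chain2[OF poly_DERIV])
       (use greater in \<open>auto intro!: derivative_eq_intros simp: power2_eq_square\<close>)
  moreover have "((\<lambda>y. exp (- 1 / y)) has_real_derivative exp (- 1 / x) * (1 / x\<^sup>2)) (at x)"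
    using greater by (auto intro!: derivative_eq_intros simp: power2_eq_square)
  ultimately have "((\<lambda>y. poly p (1 / y) * exp (- 1 / y)) has_real_derivative
      exp_bump ([:0, 0, 1:] * (p - pderiv p)) x) (at x)"
    by (rule DERIV_cong[OF DERIV_mult])
       (use greater in \<open>simp add: exp_bump_def field_simps power2_eq_square\<close>)
  then show ?thesis
    by (rule has_field_derivative_transform_within_open[where S = "{0<..}"])
       (use greater in \<open>auto simp: exp_bump_def\<close>)
qed

lemma exp_bump_1_bounds: "0 \<le> exp_bump 1 x" "exp_bump 1 x \<le> 1"
  by (auto simp: exp_bump_def)

lemma exp_bump_scaled_tendsto_1:
  assumes "x > 0"
  shows "(\<lambda>m. exp_bump 1 (real (Suc m) * x)) \<longlonglongrightarrow> 1"
proof -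
  have "(\<lambda>m. exp (- (inverse (real (Suc m)) * (1 / x)))) \<longlonglongrightarrow> exp (- (0 * (1 / x)))"
    by (intro tendsto_intros LIMSEQ_inverse_real_of_nat)
  moreover have "exp_bump 1 (real (Suc m) * x) = exp (- (inverse (real (Suc m)) * (1 / x)))" for m
    using assms by (simp only: exp_bump_def) (simp add: divide_inverse mult.commute)
  ultimately show ?thesis
    by simp
qed

lemma partial_eqI:
  assumes "\<And>x. (\<phi> has_derivative D x) (at x)"
  shows "partial b \<phi> = (\<lambda>x. D x b)"
  unfolding partial_def using frechet_derivative_at[OF assms] by metis

lemma C_k_Suc_has_derivative:
  assumes "C_k (Suc m) \<phi>"
  shows "(\<phi> has_derivative frechet_derivative \<phi> (at x)) (at x)"
  using assms by (auto simp: differentiable_on_def frechet_derivative_works[symmetric])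

lemma C_k_imp_continuous: "C_k m \<phi> \<Longrightarrow> continuous_on UNIV \<phi>"
  by (cases m) (auto simp: differentiable_imp_continuous_on)

lemma C_k_Suc_imp_C_k: "C_k (Suc m) \<phi> \<Longrightarrow> C_k m \<phi>"
proof (induction m arbitrary: \<phi>)
  case 0
  then show ?case
    using C_k_imp_continuous[of "Suc 0" \<phi>] by (simp del: C_k.simps(2))
next
  case (Suc m)
  have "C_k m (partial b \<phi>)" if "b \<in> Basis" for b
    using Suc.prems that by (intro Suc.IH) simp
  then show ?case
    using Suc.prems by simp
qed

lemma C_k_add:
  assumes "C_k m \<phi>" "C_k m \<psi>"
  shows "C_k m (\<lambda>x. \<phi> x + \<psi> x)"
  using assms
proof (induction m arbitrary: \<phi> \<psi>)
  case 0
  then show ?case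
    by (simp add: continuous_on_add)
next
  case (Suc m)
  have "partial b (\<lambda>x. \<phi> x + \<psi> x) = (\<lambda>x. partial b \<phi> x + partial b \<psi> x)" for b
    unfolding partial_def[of b \<phi>] partial_def[of b \<psi>]
    by (rule partial_eqI)
       (intro has_derivative_add Suc.prems[THEN C_k_Suc_has_derivative])
  then show ?case
    using Suc by (auto intro!: differentiable_on_add)
qed

text \<open>The product rule involves the functions themselves next to their partial derivatives, which is
  why the induction needs that the \<^const>\<open>C_k\<close> classes decrease in the order.\<close>
lemma C_k_mult:
  assumes "C_k m \<phi>" "C_k m \<psi>"
  shows "C_k m (\<lambda>x. \<phi> x * \<psi> x)"
  using assms
proof (induction m arbitrary: \<phi> \<psi>)
  case 0
  then show ?case
    by (simp add: continuous_on_mult)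
next
  case (Suc m)
  have "partial b (\<lambda>x. \<phi> x * \<psi> x) = (\<lambda>x. \<phi> x * partial b \<psi> x + partial b \<phi> x * \<psi> x)" for b
    unfolding partial_def[of b \<phi>] partial_def[of b \<psi>]
    by (rule partial_eqI)
       (intro has_derivative_mult Suc.prems[THEN C_k_Suc_has_derivative])
  moreover have "C_k m (\<lambda>x. \<phi> x * partial b \<psi> x + partial b \<phi> x * \<psi> x)" if "b \<in> Basis" for b
    using Suc.prems[THEN C_k_Suc_imp_C_k] Suc.prems that by (intro C_k_add Suc.IH) auto
  ultimately show ?case
    using Suc.prems by (auto intro!: differentiable_on_mult)
qed

lemma C_k_const: "C_k m (\<lambda>x :: 'a :: euclidean_space. c)"
proof (induction m arbitrary: c)
  case (Suc m)
  have "partial b (\<lambda>x. c) = (\<lambda>x. 0)" for b :: 'a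
    by (rule partial_eqI) (rule has_derivative_const)
  then show ?case
    using Suc by (simp add: differentiable_on_const)
qed simp

lemma C_k_prod:
  assumes "finite I" "\<And>i. i \<in> I \<Longrightarrow> C_k m (\<phi> i)"
  shows "C_k m (\<lambda>x. \<Prod>i\<in>I. \<phi> i x)"
  using assms by (induction I rule: finite_induct) (simp_all add: C_k_const C_k_mult)

lemma exp_bump_affine_has_derivative:
  "((\<lambda>x. exp_bump p (w \<bullet> x + d)) has_derivative
     (\<lambda>h. exp_bump ([:0, 0, 1:] * (p - pderiv p)) (w \<bullet> x + d) * (w \<bullet> h))) (at x)"
proof -
  have "((\<lambda>x. w \<bullet> x + d) has_derivative (\<lambda>h. w \<bullet> h)) (at x)"
    by (auto intro!: derivative_eq_intros)
  from has_derivative_compose[OF this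
      exp_bump_has_derivative[unfolded has_field_derivative_def]]
  show ?thesis .
qed

lemma C_k_exp_bump_affine: "C_k m (\<lambda>x. exp_bump p (w \<bullet> x + d))"
proof (induction m arbitrary: p)
  case 0
  show ?case
    unfolding C_k.simps
    by (intro continuous_at_imp_continuous_on ballI
        has_derivative_continuous[OF exp_bump_affine_has_derivative])
next
  case (Suc m)
  have "partial b (\<lambda>x. exp_bump p (w \<bullet> x + d))
      = (\<lambda>x. exp_bump (smult (w \<bullet> b) ([:0, 0, 1:] * (p - pderiv p))) (w \<bullet> x + d))" for b
    by (subst partial_eqI[OF exp_bump_affine_has_derivative]) (simp add: fun_eq_iff exp_bump_def)
  moreover have "(\<lambda>x. exp_bump p (w \<bullet> x + d)) differentiable_on UNIV"
    unfolding differentiable_on_def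
    by (intro ballI differentiableI[OF exp_bump_affine_has_derivative])
  ultimately show ?case
    by (simp only: C_k.simps Suc.IH) simp
qed

text \<open>The factor \<open>Suc m\<close> steepens the profile: as \<open>m\<close> grows, \<open>exp_bump 1\<close> of a positive number times
  \<open>Suc m\<close> tends to \<open>1\<close>.\<close>
definition box_bump :: "'a::euclidean_space \<Rightarrow> 'a \<Rightarrow> nat \<Rightarrow> 'a \<Rightarrow> real" where
  "box_bump a c m x =
     (\<Prod>b\<in>Basis. exp_bump 1 (real (Suc m) * (x \<bullet> b - a \<bullet> b)) *
                  exp_bump 1 (real (Suc m) * (c \<bullet> b - x \<bullet> b)))"

lemma box_bump_eq_0:
  assumes "x \<notin> box a c"
  shows "box_bump a c m x = 0"
proof -
  obtain b where b: "b \<in> Basis" "x \<bullet> b \<le> a \<bullet> b \<or> c \<bullet> b \<le> x \<bullet> b"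
    using assms by (auto simp: mem_box not_less)
  then have "real (Suc m) * (x \<bullet> b - a \<bullet> b) \<le> 0 \<or> real (Suc m) * (c \<bullet> b - x \<bullet> b) \<le> 0"
    by (auto simp: mult_le_0_iff)
  then show ?thesis
    unfolding box_bump_def
    by (intro prod_zero bexI[OF _ b(1)]) (auto simp: exp_bump_def)
qed

lemma box_bump_bounds: "0 \<le> box_bump a c m x" "box_bump a c m x \<le> 1"
  unfolding box_bump_def
  by (intro prod_nonneg prod_le_1 conjI mult_nonneg_nonneg mult_le_one exp_bump_1_bounds)+

lemma box_bump_tendsto_indicator:
  "(\<lambda>m. box_bump a c m x) \<longlonglongrightarrow> indicator (box a c) x"
proof (cases "x \<in> box a c")
  case True
  have "(\<lambda>m. box_bump a c m x) \<longlonglongrightarrow> (\<Prod>b\<in>(Basis :: 'a set). 1 * 1)"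
    unfolding box_bump_def
    by (intro tendsto_prod tendsto_mult exp_bump_scaled_tendsto_1)
       (use True in \<open>auto simp: mem_box\<close>)
  then show ?thesis
    using True by simp
qed (simp add: box_bump_eq_0)

lemma box_bump_test_function:
  assumes "cbox a c \<subseteq> S"
  shows "box_bump a c m \<in> test_functions S"
proof -
  have lower: "C_k n (\<lambda>x. exp_bump 1 (real (Suc m) * (x \<bullet> b - a \<bullet> b)))" for n b
    using C_k_exp_bump_affine[of n 1 "real (Suc m) *\<^sub>R b" "- real (Suc m) * (a \<bullet> b)"]
    by (simp add: right_diff_distrib inner_commute del: of_nat_Suc)
  have upper: "C_k n (\<lambda>x. exp_bump 1 (real (Suc m) * (c \<bullet> b - x \<bullet> b)))" for n b
    using C_k_exp_bump_affine[of n 1 "- real (Suc m) *\<^sub>R b" "real (Suc m) * (c \<bullet> b)"]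
    by (simp add: right_diff_distrib inner_commute del: of_nat_Suc)
  have smooth: "C_k n (box_bump a c m)" for n
    unfolding box_bump_def[abs_def] by (rule C_k_prod[OF finite_Basis C_k_mult[OF lower upper]])
  have "{x. box_bump a c m x \<noteq> 0} \<subseteq> cbox a c"
    using box_bump_eq_0 box_subset_cbox by blast
  then have "closure {x. box_bump a c m x \<noteq> 0} \<subseteq> cbox a c"
    by (rule closure_minimal[OF _ closed_cbox])
  moreover from this have "compact (closure {x. box_bump a c m x \<noteq> 0})"
    by (meson bounded_cbox bounded_subset closed_closure compact_eq_bounded_closed)
  ultimately show ?thesis
    using smooth assms by (auto simp: test_functions_def)
qed

section \<open>The fundamental lemma of the calculus of variations\<close>

text \<open>The bumps converge boundedly to the indicator of the open box, so the limit of the vanishing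
  integrals is the integral over the box.\<close>
lemma integral_cbox_eq_0_if_orthogonal:
  fixes g :: "'a::euclidean_space \<Rightarrow> real"
  assumes S: "open S" and g: "integrable (lebesgue_on S) g"
    and orth: "\<And>\<phi>. \<phi> \<in> test_functions S \<Longrightarrow> L2_inner S g \<phi> = 0"
    and sub: "cbox a c \<subseteq> S"
  shows "integral (cbox a c) g = 0"
proof -
  have meas: "box_bump a c m \<in> borel_measurable (lebesgue_on S)" for m
    using box_bump_test_function[OF order_refl, of a c m]
    by (intro continuous_imp_measurable_on_sets_lebesgue)
       (auto simp: test_functions_def S lmeasurable_open
             intro!: continuous_on_subset[OF C_k_imp_continuous[of 0]])
  have box: "box a c \<in> sets lebesgue" "box a c \<subseteq> S"
    using sub box_subset_cbox by auto
  have ind: "indicator (box a c) \<in> borel_measurable (lebesgue_on S)"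
    using box S by (auto intro!: borel_measurable_indicator simp: sets_restrict_space_iff)
  have "(\<lambda>m. LINT x|lebesgue_on S. g x * box_bump a c m x)
      \<longlonglongrightarrow> (LINT x|lebesgue_on S. g x * indicator (box a c) x)"
  proof (rule integral_dominated_convergence[where w = "\<lambda>x. \<bar>g x\<bar>"])
    show "AE x in lebesgue_on S. norm (g x * box_bump a c m x) \<le> \<bar>g x\<bar>" for m
      using box_bump_bounds[of a c m] by (auto simp: abs_mult intro!: mult_left_le)
    show "AE x in lebesgue_on S. (\<lambda>m. g x * box_bump a c m x) \<longlonglongrightarrow> g x * indicator (box a c) x"
      by (intro AE_I2 tendsto_intros box_bump_tendsto_indicator)
  qed (use g meas ind borel_measurable_integrable[OF g] in \<open>auto intro!: borel_measurable_times\<close>)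
  moreover have "(LINT x|lebesgue_on S. g x * box_bump a c m x) = 0" for m
    using orth[OF box_bump_test_function[OF sub]] by (simp add: L2_inner_def)
  ultimately have "(LINT x|lebesgue_on S. g x * indicator (box a c) x) = 0"
    by (simp add: LIMSEQ_const_iff)
  moreover have "(LINT x|lebesgue_on S. g x * indicator (box a c) x)
      = integral S (\<lambda>x. g x * indicator (box a c) x)"
    by (rule lebesgue_integral_eq_integral)
       (use S ind g in \<open>auto intro!: integrable_real_mult_indicator simp: box sets_restrict_space_iff\<close>)
  moreover have "integral S (\<lambda>x. g x * indicator (box a c) x) = integral (box a c) g"
    using integral_restrict_Int[of S "box a c" g] box
    by (simp add: Int_absorb2 indicator_def of_bool_def if_distrib cong: if_cong)
  ultimately show ?thesis
    by (simp add: integral_open_interval)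
qed

text \<open>The fundamental lemma of the calculus of variations. Almost every point is a Lebesgue point with
  respect to small cubes, and the averages over the cubes contained in \<open>S\<close> vanish.\<close>
lemma ae_zero_if_orthogonal_test_functions:
  fixes g :: "'a::euclidean_space \<Rightarrow> real"
  assumes S: "open S" and g: "integrable (lebesgue_on S) g"
    and orth: "\<And>\<phi>. \<phi> \<in> test_functions S \<Longrightarrow> L2_inner S g \<phi> = 0"
  shows "AE x in lebesgue_on S. g x = 0"
proof -
  define f where "f x = (if x \<in> S then g x else 0)" for x
  have "g integrable_on S"
    using g S by (simp add: integrable_on_lebesgue_on)
  then have "f integrable_on UNIV"
    by (simp add: f_def[abs_def] integrable_restrict_UNIV)
  then have "f integrable_on cbox a b" for a b
    by (rule integrable_on_subcbox) simp
  then obtain N where N: "negligible N" and lebesgue_point: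
    "\<And>x e. x \<notin> N \<Longrightarrow> 0 < e \<Longrightarrow> \<exists>d>0. \<forall>h. 0 < h \<and> h < d \<longrightarrow>
        norm (integral (cbox x (x + h *\<^sub>R One)) f /\<^sub>R h ^ DIM('a) - f x) < e"
    using integrable_ccontinuous_explicit by metis
  have "g x = 0" if x: "x \<in> S" "x \<notin> N" for x
  proof (rule ccontr)
    assume "g x \<noteq> 0"
    then obtain d where d: "d > 0" and small: "\<And>h. 0 < h \<Longrightarrow> h < d \<Longrightarrow>
        norm (integral (cbox x (x + h *\<^sub>R One)) f /\<^sub>R h ^ DIM('a) - f x) < \<bar>f x\<bar>"
      using lebesgue_point[of x "\<bar>f x\<bar>"] x by (auto simp: f_def)
    obtain r where r: "r > 0" "ball x r \<subseteq> S"
      using S x openE by blast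
    \<comment> \<open>The cube of side \<open>h\<close> at \<open>x\<close> lies in the ball of radius \<open>r\<close> because the norm
      is at most the sum of the absolute coordinates, hence the factor \<open>DIM('a)\<close>.\<close>
    define h where "h = min (d / 2) (r / (2 * DIM('a)))"
    have h: "0 < h" "h < d" "h * DIM('a) < r"
      using d r DIM_positive[where 'a = 'a] by (auto simp: h_def min_def field_simps)
    have "cbox x (x + h *\<^sub>R One) \<subseteq> ball x r"
    proof
      fix y assume y: "y \<in> cbox x (x + h *\<^sub>R One)"
      have "norm (y - x) \<le> (\<Sum>b\<in>Basis. \<bar>(y - x) \<bullet> b\<bar>)"
        by (rule norm_le_l1)
      also have "\<dots> \<le> (\<Sum>b\<in>(Basis :: 'a set). h)"
        using y by (intro sum_mono) (auto simp: mem_box inner_diff_left inner_add_left algebra_simps)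
      also have "\<dots> < r"
        using h by (simp add: mult.commute)
      finally show "y \<in> ball x r"
        by (simp add: dist_norm norm_minus_commute)
    qed
    then have sub: "cbox x (x + h *\<^sub>R One) \<subseteq> S"
      using r by blast
    have "integral (cbox x (x + h *\<^sub>R One)) f = integral (cbox x (x + h *\<^sub>R One)) g"
      using sub by (intro Henstock_Kurzweil_Integration.integral_cong) (auto simp: f_def)
    also have "\<dots> = 0"
      by (rule integral_cbox_eq_0_if_orthogonal[OF S g orth sub])
    finally show False
      using small[OF h(1,2)] by simp
  qed
  then have "AE x in lebesgue. x \<in> S \<longrightarrow> g x = 0"
    using N by (intro AE_I'[of N]) (auto simp: negligible_iff_null_sets)
  then show ?thesis
    using S by (simp add: AE_restrict_space_iff)
qed

section \<open>Linearity of the weak gradient\<close>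

lemma L2_integrable_inner:
  assumes "u \<in> L2 S" "v \<in> L2 S"
  shows "integrable (lebesgue_on S) (\<lambda>x. u x \<bullet> v x)"
proof (rule Bochner_Integration.integrable_bound)
  show "integrable (lebesgue_on S) (\<lambda>x. (norm (u x))\<^sup>2 + (norm (v x))\<^sup>2)"
    using assms by (auto simp: L2_def)
  show "(\<lambda>x. u x \<bullet> v x) \<in> borel_measurable (lebesgue_on S)"
    using assms by (auto simp: L2_def)
  have "\<bar>u x \<bullet> v x\<bar> \<le> (norm (u x))\<^sup>2 + (norm (v x))\<^sup>2" for x
  proof -
    have "\<bar>u x \<bullet> v x\<bar> \<le> norm (u x) * norm (v x)"
      by (rule Cauchy_Schwarz_ineq2)
    also have "\<dots> \<le> 2 * norm (u x) * norm (v x)"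
      by simp
    also have "\<dots> \<le> (norm (u x))\<^sup>2 + (norm (v x))\<^sup>2"
      by (rule sum_squares_bound)
    finally show ?thesis .
  qed
  then show "AE x in lebesgue_on S. norm (u x \<bullet> v x) \<le> norm ((norm (u x))\<^sup>2 + (norm (v x))\<^sup>2)"
    by (intro AE_I2) (simp add: order_trans[OF _ abs_ge_self])
qed

lemma L2_lincomb:
  assumes "u \<in> L2 S" "v \<in> L2 S"
  shows "(\<lambda>x. c *\<^sub>R u x + d *\<^sub>R v x) \<in> L2 S"
proof -
  have "(\<lambda>x. (norm (c *\<^sub>R u x + d *\<^sub>R v x))\<^sup>2)
      = (\<lambda>x. c\<^sup>2 * (u x \<bullet> u x) + 2 * c * d * (u x \<bullet> v x) + d\<^sup>2 * (v x \<bullet> v x))"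
    unfolding power2_norm_eq_inner
    by (simp add: fun_eq_iff inner_add_left inner_add_right inner_commute algebra_simps power2_eq_square)
  moreover have "integrable (lebesgue_on S) \<dots>"
    by (intro Bochner_Integration.integrable_add integrable_mult_right L2_integrable_inner assms)
  moreover have "u \<in> borel_measurable (lebesgue_on S)" "v \<in> borel_measurable (lebesgue_on S)"
    using assms by (auto simp: L2_def)
  ultimately show ?thesis
    by (simp add: L2_def)
qed

lemma L2_lincomb_real:
  fixes u v :: "'a::euclidean_space \<Rightarrow> real"
  assumes "u \<in> L2 S" "v \<in> L2 S"
  shows "(\<lambda>x. c * u x + d * v x) \<in> L2 S"
  using L2_lincomb[OF assms] by simp

lemma L2_inner_lincomb_left:
  assumes "u \<in> L2 S" "v \<in> L2 S" "w \<in> L2 S"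
  shows "L2_inner S (\<lambda>x. c *\<^sub>R u x + d *\<^sub>R v x) w = c * L2_inner S u w + d * L2_inner S v w"
  unfolding L2_inner_def
  by (simp add: inner_add_left Bochner_Integration.integral_add L2_integrable_inner assms)

lemma L2_inner_lincomb_left_real:
  fixes u v w :: "'a::euclidean_space \<Rightarrow> real"
  assumes "u \<in> L2 S" "v \<in> L2 S" "w \<in> L2 S"
  shows "L2_inner S (\<lambda>x. c * u x + d * v x) w = c * L2_inner S u w + d * L2_inner S v w"
  using L2_inner_lincomb_left[OF assms] by simp

lemma L2_inner_cong_AE:
  assumes "u \<in> L2 S" "u' \<in> L2 S" "v \<in> L2 S" "AE x in lebesgue_on S. u x = u' x"
  shows "L2_inner S u v = L2_inner S u' v"
  unfolding L2_inner_def
proof (rule integral_cong_AE)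
  show "AE x in lebesgue_on S. u x \<bullet> v x = u' x \<bullet> v x"
    using assms(4) by eventually_elim simp
qed (use assms in \<open>auto simp: L2_def\<close>)

lemma L2_inner_zero_left: "L2_inner S (\<lambda>x. 0) v = 0"
  by (simp add: L2_inner_def)

lemma L2_zero: "(\<lambda>x. 0) \<in> L2 S"
  by (simp add: L2_def)

lemma L2_component:
  assumes "g \<in> L2 S"
  shows "(\<lambda>x. g x \<bullet> b) \<in> L2 S"
proof -
  have meas: "g \<in> borel_measurable (lebesgue_on S)"
    using assms by (simp add: L2_def)
  have "integrable (lebesgue_on S) (\<lambda>x. (norm (g x \<bullet> b))\<^sup>2)"
  proof (rule Bochner_Integration.integrable_bound)
    show "integrable (lebesgue_on S) (\<lambda>x. (norm (g x))\<^sup>2 * (norm b)\<^sup>2)"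
      using assms by (simp add: L2_def)
    have "(norm (g x \<bullet> b))\<^sup>2 \<le> (norm (g x))\<^sup>2 * (norm b)\<^sup>2" for x
      using power_mono[OF Cauchy_Schwarz_ineq2[of "g x" b], of 2] by (simp add: power_mult_distrib)
    then show "AE x in lebesgue_on S. norm ((norm (g x \<bullet> b))\<^sup>2) \<le> norm ((norm (g x))\<^sup>2 * (norm b)\<^sup>2)"
      by (intro AE_I2) (simp add: abs_mult)
  qed (use meas in simp)
  then show ?thesis
    using meas by (simp add: L2_def)
qed

lemma continuous_imp_L2:
  fixes \<phi> :: "'a::euclidean_space \<Rightarrow> real"
  assumes S: "open S" "bounded S" and cont: "continuous_on UNIV \<phi>"
  shows "\<phi> \<in> L2 S"
proof -
  interpret finite_measure "lebesgue_on S"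
    using S by (intro finite_measure_lebesgue_on lmeasurable_open)
  have meas: "\<phi> \<in> borel_measurable (lebesgue_on S)"
    using S by (intro continuous_imp_measurable_on_sets_lebesgue continuous_on_subset[OF cont])
               (auto intro: lmeasurable_open fmeasurableD)
  have "bounded (\<phi> ` closure S)"
    using S by (intro compact_imp_bounded compact_continuous_image continuous_on_subset[OF cont]) auto
  then obtain B where B: "\<And>x. x \<in> S \<Longrightarrow> norm (\<phi> x) \<le> B"
    unfolding bounded_iff using closure_subset by blast
  have "integrable (lebesgue_on S) (\<lambda>x. (norm (\<phi> x))\<^sup>2)"
  proof (rule integrable_const_bound)
    show "AE x in lebesgue_on S. norm ((norm (\<phi> x))\<^sup>2) \<le> B\<^sup>2"
      using power_mono[OF B, of _ 2] by (intro AE_I2) simp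
  qed (use meas in simp)
  then show ?thesis
    using meas by (simp add: L2_def)
qed

lemma test_function_L2:
  assumes "open S" "bounded S" "\<phi> \<in> test_functions S"
  shows "\<phi> \<in> L2 S"
proof -
  have "C_k 0 \<phi>"
    using assms(3) unfolding test_functions_def by blast
  then show ?thesis
    using assms by (intro continuous_imp_L2) auto
qed

lemma partial_test_function_L2:
  assumes "open S" "bounded S" "\<phi> \<in> test_functions S" "b \<in> Basis"
  shows "partial b \<phi> \<in> L2 S"
proof -
  have "C_k (Suc 0) \<phi>"
    using assms(3) unfolding test_functions_def by blast
  then show ?thesis
    using assms by (intro continuous_imp_L2) auto
qed

lemma L2_imp_integrable:
  fixes g :: "'a::euclidean_space \<Rightarrow> real"
  assumes "open S" "bounded S" "g \<in> L2 S"
  shows "integrable (lebesgue_on S) g"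
  using L2_integrable_inner[OF assms(3) continuous_imp_L2[OF assms(1,2) continuous_on_const[of _ 1]]]
  by simp

lemma weak_gradient_lincomb:
  assumes S: "open S" "bounded S"
    and L2: "u \<in> L2 S" "v \<in> L2 S" "g \<in> L2 S" "h \<in> L2 S"
    and grads: "weak_gradient S u g" "weak_gradient S v h"
  shows "weak_gradient S (\<lambda>x. c * u x + d * v x) (\<lambda>x. c *\<^sub>R g x + d *\<^sub>R h x)"
  unfolding weak_gradient_def
proof (intro ballI)
  fix \<phi> and b :: 'a assume \<phi>: "\<phi> \<in> test_functions S" and b: "b \<in> Basis"
  have eqs: "L2_inner S u (partial b \<phi>) = - L2_inner S (\<lambda>x. g x \<bullet> b) \<phi>"
      "L2_inner S v (partial b \<phi>) = - L2_inner S (\<lambda>x. h x \<bullet> b) \<phi>"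
    using grads \<phi> b by (auto simp: weak_gradient_def)
  have "L2_inner S (\<lambda>x. c * u x + d * v x) (partial b \<phi>)
      = c * L2_inner S u (partial b \<phi>) + d * L2_inner S v (partial b \<phi>)"
    by (intro L2_inner_lincomb_left_real partial_test_function_L2 S L2 \<phi> b)
  also have "\<dots> = - (c * L2_inner S (\<lambda>x. g x \<bullet> b) \<phi> + d * L2_inner S (\<lambda>x. h x \<bullet> b) \<phi>)"
    by (simp add: eqs)
  also have "\<dots> = - L2_inner S (\<lambda>x. c * (g x \<bullet> b) + d * (h x \<bullet> b)) \<phi>"
    by (subst L2_inner_lincomb_left_real) (auto intro: L2_component test_function_L2 S L2 \<phi>)
  finally show "L2_inner S (\<lambda>x. c * u x + d * v x) (partial b \<phi>)
      = - L2_inner S (\<lambda>x. (c *\<^sub>R g x + d *\<^sub>R h x) \<bullet> b) \<phi>"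
    by (simp add: inner_add_left)
qed

text \<open>Each component of the difference of two weak gradients is orthogonal to all test functions.\<close>
lemma weak_gradient_unique_AE:
  assumes S: "open S" "bounded S"
    and L2: "g \<in> L2 S" "h \<in> L2 S"
    and grads: "weak_gradient S u g" "weak_gradient S u h"
  shows "AE x in lebesgue_on S. g x = h x"
proof -
  \<comment> \<open>The difference is written as \<open>1 * _ + (- 1) * _\<close> so that the lemmas on linear combinations
    apply.\<close>
  have "AE x in lebesgue_on S. 1 * (g x \<bullet> b) + (- 1) * (h x \<bullet> b) = 0" if b: "b \<in> Basis" for b
  proof (rule ae_zero_if_orthogonal_test_functions[OF S(1)])
    show "integrable (lebesgue_on S) (\<lambda>x. 1 * (g x \<bullet> b) + (- 1) * (h x \<bullet> b))"
      by (intro L2_imp_integrable L2_lincomb_real L2_component S L2)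
  next
    fix \<phi> assume \<phi>: "\<phi> \<in> test_functions S"
    have "L2_inner S (\<lambda>x. g x \<bullet> b) \<phi> = L2_inner S (\<lambda>x. h x \<bullet> b) \<phi>"
      using grads \<phi> b by (simp add: weak_gradient_def)
    then show "L2_inner S (\<lambda>x. 1 * (g x \<bullet> b) + (- 1) * (h x \<bullet> b)) \<phi> = 0"
      by (subst L2_inner_lincomb_left_real) (auto intro: L2_component test_function_L2 S L2 \<phi>)
  qed
  then have "AE x in lebesgue_on S. \<forall>b\<in>Basis. g x \<bullet> b = h x \<bullet> b"
    by (intro AE_finite_allI) auto
  then show ?thesis
    by eventually_elim (auto intro: euclidean_eqI)
qed

lemma grad_L2_weak_gradient:
  assumes "u \<in> H1 S"
  shows "grad S u \<in> L2 S" "weak_gradient S u (grad S u)"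
  using someI_ex[of "\<lambda>g. g \<in> L2 S \<and> weak_gradient S u g"] assms
  by (auto simp: grad_def H1_def)

text \<open>\<^const>\<open>grad\<close> picks an arbitrary weak gradient, so it need not be linear pointwise. By uniqueness up to
  null sets, inner products with it do not depend on the choice, and hence they are linear.\<close>
lemma L2_inner_grad_eq:
  assumes "open S" "bounded S" "u \<in> H1 S" "g \<in> L2 S" "weak_gradient S u g" "h \<in> L2 S"
  shows "L2_inner S (grad S u) h = L2_inner S g h"
  using assms grad_L2_weak_gradient[OF assms(3)]
  by (intro L2_inner_cong_AE weak_gradient_unique_AE[of S _ _ u])

lemma H1_lincomb:
  assumes "open S" "bounded S" "u \<in> H1 S" "v \<in> H1 S"
  shows "(\<lambda>x. c * u x + d * v x) \<in> H1 S"
  unfolding H1_def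
proof (intro CollectI conjI bexI)
  show "(\<lambda>x. c * u x + d * v x) \<in> L2 S"
    using assms by (intro L2_lincomb_real) (auto simp: H1_def)
  show "weak_gradient S (\<lambda>x. c * u x + d * v x) (\<lambda>x. c *\<^sub>R grad S u x + d *\<^sub>R grad S v x)"
    using assms by (intro weak_gradient_lincomb grad_L2_weak_gradient) (auto simp: H1_def)
  show "(\<lambda>x. c *\<^sub>R grad S u x + d *\<^sub>R grad S v x) \<in> L2 S"
    using assms by (intro L2_lincomb grad_L2_weak_gradient)
qed

lemma L2_inner_grad_lincomb:
  assumes "open S" "bounded S" "u \<in> H1 S" "v \<in> H1 S" "h \<in> L2 S"
  shows "L2_inner S (grad S (\<lambda>x. c * u x + d * v x)) h
           = c * L2_inner S (grad S u) h + d * L2_inner S (grad S v) h"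
proof -
  have "L2_inner S (grad S (\<lambda>x. c * u x + d * v x)) h
      = L2_inner S (\<lambda>x. c *\<^sub>R grad S u x + d *\<^sub>R grad S v x) h"
    using assms
    by (intro L2_inner_grad_eq H1_lincomb L2_lincomb weak_gradient_lincomb grad_L2_weak_gradient)
       (auto simp: H1_def)
  then show ?thesis
    using assms by (simp add: L2_inner_lincomb_left grad_L2_weak_gradient)
qed

text \<open>Only the values on \<open>S\<close> matter; this covers initial values that vanish on the domain but are
  unspecified outside.\<close>
lemma weak_gradient_zero:
  assumes "\<And>x. x \<in> S \<Longrightarrow> u x = 0"
  shows "weak_gradient S u (\<lambda>x. 0)"
proof -
  have "L2_inner S u w = 0" for w
    unfolding L2_inner_def
    by (rule Bochner_Integration.integral_cong[THEN trans, OF refl _ integral_zero])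
       (simp add: assms)
  then show ?thesis
    by (simp add: weak_gradient_def L2_inner_def)
qed

lemma zero_in_H1: "(\<lambda>x. 0) \<in> H1 S"
  unfolding H1_def by (intro CollectI conjI bexI[of _ "\<lambda>x. 0"] L2_zero weak_gradient_zero refl)

lemma L2_inner_grad_zero:
  assumes "open S" "bounded S" "u \<in> H1 S" "h \<in> L2 S" "\<And>x. x \<in> S \<Longrightarrow> u x = 0"
  shows "L2_inner S (grad S u) h = 0"
  using L2_inner_grad_eq[OF assms(1-3) L2_zero weak_gradient_zero[OF assms(5)] assms(4)]
  by (simp add: L2_inner_zero_left)

lemma L2_sum:
  fixes u :: "'i \<Rightarrow> 'a::euclidean_space \<Rightarrow> real"
  assumes "finite I" "\<And>i. i \<in> I \<Longrightarrow> u i \<in> L2 S"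
  shows "(\<lambda>x. \<Sum>i\<in>I. c i * u i x) \<in> L2 S"
  using assms
proof (induction I rule: finite_induct)
  case (insert i I)
  then show ?case
    using L2_lincomb_real[of "u i" S "\<lambda>x. \<Sum>i\<in>I. c i * u i x" "c i" 1] by simp
qed (simp add: L2_zero)

lemma L2_inner_sum_left:
  fixes u :: "'i \<Rightarrow> 'a::euclidean_space \<Rightarrow> real"
  assumes "finite I" "\<And>i. i \<in> I \<Longrightarrow> u i \<in> L2 S" "v \<in> L2 S"
  shows "L2_inner S (\<lambda>x. \<Sum>i\<in>I. c i * u i x) v = (\<Sum>i\<in>I. c i * L2_inner S (u i) v)"
  using assms
proof (induction I rule: finite_induct)
  case (insert i I)
  then show ?case
    using L2_inner_lincomb_left_real[of "u i" S "\<lambda>x. \<Sum>i\<in>I. c i * u i x" v "c i" 1]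
    by (simp add: L2_sum)
qed (simp add: L2_inner_zero_left)

lemma H1_sum:
  assumes "open S" "bounded S" "finite I" "\<And>i. i \<in> I \<Longrightarrow> u i \<in> H1 S"
  shows "(\<lambda>x. \<Sum>i\<in>I. c i * u i x) \<in> H1 S"
  using assms(3,4)
proof (induction I rule: finite_induct)
  case (insert i I)
  then show ?case
    using H1_lincomb[OF assms(1,2), of "u i" "\<lambda>x. \<Sum>i\<in>I. c i * u i x" "c i" 1] by simp
qed (simp add: zero_in_H1)

lemma L2_inner_grad_sum:
  assumes "open S" "bounded S" "finite I" "\<And>i. i \<in> I \<Longrightarrow> u i \<in> H1 S" "h \<in> L2 S"
  shows "L2_inner S (grad S (\<lambda>x. \<Sum>i\<in>I. c i * u i x)) h = (\<Sum>i\<in>I. c i * L2_inner S (grad S (u i)) h)"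
  using assms(3,4)
proof (induction I rule: finite_induct)
  case empty
  then show ?case
    using L2_inner_grad_zero[OF assms(1,2) zero_in_H1 assms(5)] by simp
next
  case (insert i I)
  then show ?case
    using L2_inner_grad_lincomb[OF assms(1,2), of "u i" "\<lambda>x. \<Sum>i\<in>I. c i * u i x" h "c i" 1]
    by (simp add: H1_sum assms)
qed

section \<open>Superposition of the leapfrog scheme\<close>

lemma V_h_imp_H1: "v \<in> V_h \<Omega> \<T> k \<Longrightarrow> v \<in> H1 \<Omega>"
  by (simp add: V_h_def H1_0_def)

lemma leapfrog_imp_H1: "leapfrog \<Omega> \<T> k \<tau> f U \<Longrightarrow> U n \<in> H1 \<Omega>"
  unfolding leapfrog_def by (rule V_h_imp_H1) blast

lemma H1_imp_L2: "u \<in> H1 S \<Longrightarrow> u \<in> L2 S"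
  by (simp add: H1_def)

lemma second_diff_L2:
  assumes "\<And>m. (\<lambda>x. W x m) \<in> L2 S"
  shows "(\<lambda>x. second_diff \<tau> (W x) m) \<in> L2 S"
proof -
  have "(p - 2 * q + r) / s = inverse s * (1 * p + (- 2) * q) + inverse s * r" for p q r s :: real
    by (simp add: divide_inverse algebra_simps)
  then show ?thesis
    unfolding second_diff_def by (simp only: L2_lincomb_real assms)
qed

text \<open>The interpolation on the first interval uses the nodes \<open>-1\<close>, \<open>0\<close> and \<open>1\<close>, so the scheme is needed
  at \<open>-1\<close> and \<open>0\<close> as well. There every term vanishes: the second differences involve only the values
  at the nodes from \<open>-2\<close> to \<open>1\<close>, which are zero on the domain, and the source vanishes at time \<open>0\<close>
  and is extended by zero.\<close>
lemma leapfrog_extended: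
  fixes \<Omega> :: "(real ^ 'd) set"
  assumes S: "open \<Omega>" "bounded \<Omega>"
    and leap: "leapfrog \<Omega> \<T> k \<tau> f U"
    and init: "\<And>x. x \<in> \<Omega> \<Longrightarrow> U 0 x = 0" "\<And>x. x \<in> \<Omega> \<Longrightarrow> U 1 x = 0"
    and f0: "f 0 \<in> L2 \<Omega>" "AE x in lebesgue_on \<Omega>. f 0 x = 0"
    and v: "v \<in> V_h \<Omega> \<T> k" and m: "m \<ge> - 1"
  shows "L2_inner \<Omega> (\<lambda>x. second_diff \<tau> (zero_ext (\<lambda>n. U n x)) m) v
           + L2_inner \<Omega> (grad \<Omega> (\<lambda>x. zero_ext (\<lambda>n. U n x) m)) (grad \<Omega> v)
         = L2_inner \<Omega> (\<lambda>x. zero_ext (\<lambda>n. f (real n * \<tau>) x) m) v"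
proof (cases "m \<ge> 1")
  case True
  define n where "n = nat m"
  have n: "m = int n" "n \<ge> 1"
    using True by (auto simp: n_def)
  have "(\<lambda>x. second_diff \<tau> (zero_ext (\<lambda>n. U n x)) m)
      = (\<lambda>x. 1 / \<tau>\<^sup>2 * (U (n + 1) x - 2 * U n x + U (n - 1) x))"
    using n by (simp add: second_diff_def zero_ext_def nat_add_distrib nat_diff_distrib)
  then have "L2_inner \<Omega> (\<lambda>x. second_diff \<tau> (zero_ext (\<lambda>n. U n x)) m) v
      = 1 / \<tau>\<^sup>2 * L2_inner \<Omega> (\<lambda>x. U (n + 1) x - 2 * U n x + U (n - 1) x) v"
    by (simp add: L2_inner_def)
  then show ?thesis
    using leap n v by (simp add: leapfrog_def zero_ext_def)
next
  case False
  then have m_cases: "m = - 1 \<or> m = 0"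
    using m by auto
  have v_L2: "v \<in> L2 \<Omega>" "grad \<Omega> v \<in> L2 \<Omega>"
    using v by (auto intro: H1_imp_L2 V_h_imp_H1 grad_L2_weak_gradient)
  have U_H1: "U 0 \<in> H1 \<Omega>"
    using leap by (rule leapfrog_imp_H1)
  have "second_diff \<tau> (zero_ext (\<lambda>n. U n x)) m = 0" if "x \<in> \<Omega>" for x
    using m_cases init[OF that] by (auto simp: second_diff_def zero_ext_def)
  then have "L2_inner \<Omega> (\<lambda>x. second_diff \<tau> (zero_ext (\<lambda>n. U n x)) m) v = 0"
    unfolding L2_inner_def
    by (intro Bochner_Integration.integral_cong[THEN trans, OF refl _ integral_zero]) simp
  moreover have "L2_inner \<Omega> (grad \<Omega> (\<lambda>x. zero_ext (\<lambda>n. U n x) m)) (grad \<Omega> v) = 0"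
    using m_cases U_H1 init
    by (intro L2_inner_grad_zero S v_L2) (auto simp: zero_ext_def zero_in_H1)
  moreover have "L2_inner \<Omega> (f 0) v = 0"
    using L2_inner_cong_AE[OF f0(1) L2_zero v_L2(1) f0(2)] by (simp add: L2_inner_zero_left)
  then have "L2_inner \<Omega> (\<lambda>x. zero_ext (\<lambda>n. f (real n * \<tau>) x) m) v = 0"
    using m_cases by (auto simp: zero_ext_def L2_inner_zero_left)
  ultimately show ?thesis
    by simp
qed

theorem lemma3p5:
  fixes \<Omega> :: "(real ^ 'd) set"
    and \<T> :: "(real ^ 'd) set set"
    and k :: nat
    and \<tau> :: real
    and f :: "real \<Rightarrow> real ^ 'd \<Rightarrow> real"
    and U :: "nat \<Rightarrow> real ^ 'd \<Rightarrow> real"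
  assumes "lipschitz_polyhedron \<Omega>"
    and "simplicial_mesh \<Omega> \<T>"
    and "k \<ge> 1"
    and "\<tau> > 0"
    and "f \<in> H1_J_L2 \<Omega> \<inter> Linf_J_L2 \<Omega>"
    and "continuous_J_L2 \<Omega> f"
    and "vanishes_near_0 \<Omega> f"
    and "leapfrog \<Omega> \<T> k \<tau> f U"
    and "\<forall>x\<in>closure \<Omega>. U 0 x = 0"
    and "\<forall>x\<in>closure \<Omega>. U 1 x = 0"
  shows "\<forall>t\<in>J. \<forall>v\<in>V_h \<Omega> \<T> k.
           L2_inner \<Omega> (time_deriv (time_deriv (L \<tau> U)) t) v
             + L2_inner \<Omega> (grad \<Omega> (R \<tau> U t)) (grad \<Omega> v)
           = L2_inner \<Omega> (R \<tau> (\<lambda>n. f (real n * \<tau>)) t) v"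
proof (intro ballI)
  fix t v assume t: "t \<in> J" and v: "v \<in> V_h \<Omega> \<T> k"
  note \<tau> = \<open>\<tau> > 0\<close>
  have S: "open \<Omega>" "bounded \<Omega>"
    using assms(1) by (auto simp: lipschitz_polyhedron_def)
  have f_L2: "f (real n * \<tau>) \<in> L2 \<Omega>" for n
    using \<tau> \<open>continuous_J_L2 \<Omega> f\<close> by (simp add: continuous_J_L2_def)
  have f0: "f 0 \<in> L2 \<Omega>" "AE x in lebesgue_on \<Omega>. f 0 x = 0"
    using f_L2[of 0] \<open>vanishes_near_0 \<Omega> f\<close> by (auto simp: vanishes_near_0_def)
  have init: "U 0 x = 0" "U 1 x = 0" if "x \<in> \<Omega>" for x
    using that assms(9,10) closure_subset by blast+
  have U: "U n \<in> H1 \<Omega>" for n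
    using \<open>leapfrog \<Omega> \<T> k \<tau> f U\<close> by (rule leapfrog_imp_H1)
  have v_L2: "v \<in> L2 \<Omega>" "grad \<Omega> v \<in> L2 \<Omega>"
    using v by (auto intro: H1_imp_L2 V_h_imp_H1 grad_L2_weak_gradient)
  define n where "n = \<lfloor>t / \<tau>\<rfloor>"
  define w where "w j = node_weight \<tau> j (t - of_int n * \<tau>)" for j
  define u where "u m x = zero_ext (\<lambda>i. U i x) m" for m x
  define D where "D m x = second_diff \<tau> (zero_ext (\<lambda>i. U i x)) m" for m x
  define F where "F m x = zero_ext (\<lambda>i. f (real i * \<tau>) x) m" for m x
  have n: "n \<ge> 0"
    using t \<tau> by (simp add: n_def)
  have u_H1: "u m \<in> H1 \<Omega>" for m
    using U zero_in_H1 by (cases "m < 0") (simp_all add: u_def[abs_def] zero_ext_def)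
  have D_L2: "D m \<in> L2 \<Omega>" for m
    unfolding D_def[abs_def]
    by (rule second_diff_L2) (use u_H1 in \<open>auto simp: u_def[abs_def] intro: H1_imp_L2\<close>)
  have F_L2: "F m \<in> L2 \<Omega>" for m
    using f_L2[of "nat m"] L2_zero
    by (cases "m < 0") (simp_all add: F_def[abs_def] zero_ext_def del: of_nat_nat)
  have "L2_inner \<Omega> (time_deriv (time_deriv (L \<tau> U)) t) v
      = L2_inner \<Omega> (\<lambda>x. \<Sum>j\<in>{-1, 0, 1}. w j * D (n + j) x) v"
    unfolding w_def D_def n_def
    by (subst time_deriv_time_deriv_L[OF \<tau> t, abs_def]) (simp only: quad_interp_def)
  also have "\<dots> = (\<Sum>j\<in>{-1, 0, 1}. w j * L2_inner \<Omega> (D (n + j)) v)"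
    by (intro L2_inner_sum_left D_L2 v_L2) simp
  finally have acceleration: "L2_inner \<Omega> (time_deriv (time_deriv (L \<tau> U)) t) v = \<dots>" .
  have "R \<tau> U t = (\<lambda>x. \<Sum>j\<in>{-1, 0, 1}. w j * u (n + j) x)"
    unfolding R_def[abs_def] w_def u_def n_def
    by (simp only: R_scalar_eq_quad_interp[OF \<tau>] quad_interp_def)
  then have stiffness: "L2_inner \<Omega> (grad \<Omega> (R \<tau> U t)) (grad \<Omega> v)
      = (\<Sum>j\<in>{-1, 0, 1}. w j * L2_inner \<Omega> (grad \<Omega> (u (n + j))) (grad \<Omega> v))"
    by (simp only:) (intro L2_inner_grad_sum S u_H1 v_L2 finite.intros)
  have "R \<tau> (\<lambda>n. f (real n * \<tau>)) t = (\<lambda>x. \<Sum>j\<in>{-1, 0, 1}. w j * F (n + j) x)"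
    unfolding R_def[abs_def] w_def F_def n_def
    by (simp only: R_scalar_eq_quad_interp[OF \<tau>] quad_interp_def)
  then have load: "L2_inner \<Omega> (R \<tau> (\<lambda>n. f (real n * \<tau>)) t) v
      = (\<Sum>j\<in>{-1, 0, 1}. w j * L2_inner \<Omega> (F (n + j)) v)"
    by (simp only:) (intro L2_inner_sum_left F_L2 v_L2 finite.intros)
  \<comment> \<open>All three terms are now combinations with the same weights, so it suffices to have the
    scheme at the three nodes. The smallest is \<open>n - 1\<close>, at least \<open>-1\<close>.\<close>
  have "L2_inner \<Omega> (D (n + j)) v + L2_inner \<Omega> (grad \<Omega> (u (n + j))) (grad \<Omega> v)
      = L2_inner \<Omega> (F (n + j)) v" if "j \<in> {-1, 0, 1}" for j
    unfolding D_def[abs_def] u_def[abs_def] F_def[abs_def]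
    by (rule leapfrog_extended[OF S \<open>leapfrog \<Omega> \<T> k \<tau> f U\<close> init f0 v]) (use that n in auto)
  then show "L2_inner \<Omega> (time_deriv (time_deriv (L \<tau> U)) t) v
      + L2_inner \<Omega> (grad \<Omega> (R \<tau> U t)) (grad \<Omega> v) = L2_inner \<Omega> (R \<tau> (\<lambda>n. f (real n * \<tau>)) t) v"
    unfolding acceleration stiffness load sum.distrib[symmetric] distrib_left[symmetric]
    by (intro sum.cong) auto
qed

end
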